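(* Let $\mathcal{A}$ be an $\mathbf{R}$-tensor of order $m\ge 2$ and dimension $n$. Then $\deg(\mathcal{A})=1$. Hence, every $\mathbf{R}$-tensor has the strong $\mathbf{Q}$-property.
   Context: A (real) tensor of order $m$ and dimension $n$ is an array $\mathcal{A}=[a_{i_1i_2\cdots i_m}]$ of real numbers, $i_1,\dots,i_m\in\{1,\dots,n\}$. It defines the polynomial map $F(x):=\mathcal{A}x^{m-1}$ on $\mathbb{R}^n$, homogeneous of degree $m-1$, with components $(\mathcal{A}x^{m-1})_i=\sum_{i_2,\dots,i_m=1}^n a_{ii_2\cdots i_m}x_{i_2}\cdots x_{i_m}$. For a polynomial map $f:\mathbb{R}^n\to\mathbb{R}^n$ and $q\in\mathbb{R}^n$, $\mathrm{PCP}(f,q)$ is the problem of finding $x$ with $x\ge 0$, $f(x)+q\ge 0$ (componentwise), $\langle x,f(x)+q\rangle=0$; $\mathrm{SOL}(f,q)$ is its solution set, and $\mathrm{SOL}(\mathcal{A},q):=\mathrm{SOL}(F,q)$. $\mathcal{A}$ has the $\mathbf{R}_0$-property if $\mathrm{SOL}(\mathcal{A},0)=\{0\}$. $\mathcal{A}$ is an $\mathbf{R}$-tensor (has the $\mathbf{R}$-property) if it has the $\mathbf{R}_0$-property and $\mathrm{SOL}(\mathcal{A},d)=\{0\}$ for some $d>0$ (all components positive). If $\mathcal{A}$ has the $\mathbf{R}_0$-property, then $\widehat{F}(x):=\min\{x,F(x)\}$ (componentwise minimum) has $0$ as its only zero, and $\deg(\mathcal{A}):=\deg(\widehat{F},0)$,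 the local (topological) degree at the origin, i.e. the Brouwer degree of $\widehat{F}$ over any bounded open set containing $0$ with respect to the value $0$. $\mathcal{A}$ has the strong $\mathbf{Q}$-property if $\mathrm{PCP}(F+P,q)$ has a nonempty compact solution set for all $q\in\mathbb{R}^n$ and all polynomial maps $P:\mathbb{R}^n\to\mathbb{R}^n$ of degree less than $m-1$; equivalently, $\mathrm{PCP}(f,q)$ has a nonempty compact solution set for all $q$ and all polynomial maps $f$ whose leading term (highest-degree homogeneous part) is $\mathcal{A}x^{m-1}$. *)

theory Defs
  imports "HOL-Analysis.Analysis" "HOL-Homology.Homology"
begin

section \<open>Brouwer degree\<close>

text \<open>
  The degree of \<open>f\<close> over a bounded open set \<open>U\<close> with respect to a value \<open>p\<close>, for \<open>f\<close>
  continuous on the closure of \<open>U\<close> and \<open>p\<close> not attained on the frontier of \<open>U\<close>, so that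
  \<open>K = {x \<in> U. f x = p}\<close> is compact. This is the standard homological definition. Writing
  \<open>n\<close> for the dimension and \<open>E\<close> for the whole space, and taking any open ball \<open>B\<close> around
  the origin that contains \<open>U\<close> and \<open>p\<close>, consider

    \<open>H\<^sub>n(E, E - B) \<longrightarrow> H\<^sub>n(E, E - K) \<longleftarrow> H\<^sub>n(U, U - K) \<longrightarrow> H\<^sub>n(E, E - {p}) \<longleftarrow> H\<^sub>n(E, E - B)\<close>

  where the third map is induced by \<open>f\<close> and the others by inclusion. The second map is an
  isomorphism by excision, the last one because \<open>p \<in> B\<close>, and both ends are infinite cyclic;
  the degree is the integer \<open>d\<close> such that the composite, from left to right, is
  multiplication by \<open>d\<close>. The same class \<open>z\<close> is used at both ends, so no choice of
  orientation is involved. The homology groups are written multiplicatively in the library,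
  so multiplication by \<open>d\<close> is the \<open>d\<close>-th power.
  If the conditions on \<open>f\<close>, \<open>U\<close>, \<open>p\<close> are violated, the value has no meaning.
\<close>

definition brouwer_degree ::
  "('a::euclidean_space \<Rightarrow> 'a) \<Rightarrow> 'a set \<Rightarrow> 'a \<Rightarrow> int" where
  "brouwer_degree f U p =
    (let n = int DIM('a); K = {x \<in> U. f x = p} in
     THE d. \<forall>r z w.
       U \<subseteq> ball 0 r \<and> p \<in> ball 0 r \<and>
       z \<in> carrier (relative_homology_group n euclidean (- ball 0 r)) \<and>
       w \<in> carrier (relative_homology_group n (top_of_set U) (U - K)) \<and>
       hom_induced n (top_of_set U) (U - K) euclidean (- K) id w =
         hom_induced n euclidean (- ball 0 r) euclidean (- K) id z \<longrightarrow>
       hom_induced n (top_of_set U) (U - K) euclidean (- {p}) f w =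
         hom_induced n euclidean (- ball 0 r) euclidean (- {p}) id z
           [^]\<^bsub>relative_homology_group n euclidean (- {p})\<^esub> (d::int))"

text \<open>
  Local degree at an isolated solution \<open>a\<close> of \<open>f x = f a\<close>: the common degree over all
  bounded open neighbourhoods of \<open>a\<close> whose closure contains no other solution.
\<close>

definition local_degree :: "('a::euclidean_space \<Rightarrow> 'a) \<Rightarrow> 'a \<Rightarrow> int" where
  "local_degree f a =
    (THE d. \<forall>U. open U \<and> bounded U \<and> a \<in> U \<and> (\<forall>x\<in>closure U. f x = f a \<longrightarrow> x = a) \<longrightarrow>
       brouwer_degree f U (f a) = d)"


section \<open>Polynomial complementarity problems\<close>

definition PCP_SOL :: "(real ^ 'n \<Rightarrow> real ^ 'n) \<Rightarrow> real ^ 'n \<Rightarrow> (real ^ 'n) set" where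
  "PCP_SOL f q = {x. (\<forall>i. 0 \<le> x $ i) \<and> (\<forall>i. 0 \<le> (f x + q) $ i) \<and> inner x (f x + q) = 0}"

text \<open>Polynomial maps all of whose components have total degree less than \<open>k\<close>; \<open>\<alpha>\<close> ranges
  over exponent vectors.\<close>

definition poly_map_degree_less :: "nat \<Rightarrow> (real ^ 'n \<Rightarrow> real ^ 'n) \<Rightarrow> bool" where
  "poly_map_degree_less k P \<longleftrightarrow>
    (\<exists>c :: 'n \<Rightarrow> ('n \<Rightarrow> nat) \<Rightarrow> real. \<forall>x i.
       P x $ i = (\<Sum>\<alpha> | (\<Sum>j\<in>UNIV. \<alpha> j) < k. c i \<alpha> * (\<Prod>j\<in>UNIV. (x $ j) ^ \<alpha> j)))"


section \<open>Tensors\<close>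

text \<open>
  A tensor of order \<open>m\<close> and dimension \<open>CARD('n)\<close> is a function \<open>A\<close> on index lists over \<open>'n\<close>,
  of which only the values at lists of length \<open>m\<close> are ever used.
\<close>

definition tensor_map :: "nat \<Rightarrow> ('n::finite list \<Rightarrow> real) \<Rightarrow> real ^ 'n \<Rightarrow> real ^ 'n" where
  "tensor_map m A x =
    (\<chi> i. \<Sum>js | length js = m - 1. A (i # js) * (\<Prod>j\<leftarrow>js. x $ j))"

definition R0_tensor :: "nat \<Rightarrow> ('n::finite list \<Rightarrow> real) \<Rightarrow> bool" where
  "R0_tensor m A \<longleftrightarrow> PCP_SOL (tensor_map m A) 0 = {0}"

definition R_tensor :: "nat \<Rightarrow> ('n::finite list \<Rightarrow> real) \<Rightarrow> bool" where
  "R_tensor m A \<longleftrightarrow> R0_tensor m A \<and> (\<exists>d. (\<forall>i. 0 < d $ i) \<and> PCP_SOL (tensor_map m A) d = {0})"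

definition min_map :: "(real ^ 'n \<Rightarrow> real ^ 'n) \<Rightarrow> real ^ 'n \<Rightarrow> real ^ 'n" where
  "min_map f x = (\<chi> i. min (x $ i) (f x $ i))"

definition tensor_degree :: "nat \<Rightarrow> ('n::finite list \<Rightarrow> real) \<Rightarrow> int" where
  "tensor_degree m A = local_degree (min_map (tensor_map m A)) 0"

definition strong_Q_tensor :: "nat \<Rightarrow> ('n::finite list \<Rightarrow> real) \<Rightarrow> bool" where
  "strong_Q_tensor m A \<longleftrightarrow>
    (\<forall>P q. poly_map_degree_less (m - 1) P \<longrightarrow>
       PCP_SOL (\<lambda>x. tensor_map m A x + P x) q \<noteq> {} \<and>
       compact (PCP_SOL (\<lambda>x. tensor_map m A x + P x) q))"

end

theory Submission
  imports Defs
begin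

text \<open>
  Let \<open>F\<close> be the homogeneous map of the tensor and \<open>d > 0\<close> with \<open>SOL(F, d) = {0}\<close>. By
  homogeneity \<open>min{x, F(x) + t d}\<close> has \<open>0\<close> as its only zero for every \<open>t \<in> [0, 1]\<close>, so
  \<open>min{x, F(x)}\<close> is homotopic to \<open>h(x) = min{x, F(x) + d}\<close> as a map of pairs into
  \<open>(E, E - {0})\<close>. Since \<open>h\<close> is the identity near \<open>0\<close>, the homotopy \<open>h(s x) / s\<close> with \<open>s\<close>
  decreasing from \<open>1\<close> to a small positive number takes \<open>h\<close> to the identity on any bounded set;
  hence the degree is \<open>1\<close>. Adding to \<open>F\<close> a map of lower growth keeps the zeros bounded,
  uniformly along the linear homotopy, so on a large sphere the perturbed minimum map is still
  homotopic to the identity in \<open>E - {0}\<close> and must have a zero inside.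
\<close>

section \<open>Homology of the punctured Euclidean space\<close>

text \<open>The orthonormal basis gives a homeomorphism from \<open>Euclidean_space\<close> that
  preserves the norm. It therefore matches the two origins and carries the computation for real
  sequences over to the type.\<close>

lemma relative_homology_group_punctured_euclidean:
  "relative_homology_group (int DIM('a)) (euclidean :: 'a::euclidean_space topology) (- {0})
     \<cong> integer_group"
proof -
  let ?n = "DIM('a)" and ?E = "euclidean :: 'a topology" and ?o = "\<lambda>i::nat. 0::real"
  obtain f :: "(nat \<Rightarrow> real) \<Rightarrow> 'a" and g
    where fg: "homeomorphic_maps (Euclidean_space ?n) (top_of_set (span Basis)) f g"
      and nf: "\<And>x. x \<in> topspace (Euclidean_space ?n) \<Longrightarrow> (norm (f x))\<^sup>2 = (\<Sum>i<?n. (x i)\<^sup>2)"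
    using homeomorphic_maps_Euclidean_space_euclidean_gen [OF independent_Basis orthogonal_Basis refl norm_Basis]
    by blast
  have hm: "homeomorphic_map (Euclidean_space ?n) ?E f"
    using fg homeomorphic_map_maps by (metis span_Basis subtopology_UNIV)
  have f0: "f x = 0 \<longleftrightarrow> x = ?o" if x: "x \<in> topspace (Euclidean_space ?n)" for x
  proof -
    have "f x = 0 \<longleftrightarrow> (\<Sum>i<?n. (x i)\<^sup>2) = 0"
      using nf [OF x] by (metis norm_eq_zero power_eq_0_iff zero_power2)
    also have "\<dots> \<longleftrightarrow> (\<forall>i<?n. x i = 0)"
      by (subst sum_nonneg_eq_0_iff) auto
    also have "\<dots> \<longleftrightarrow> x = ?o"
      using x unfolding topspace_Euclidean_space fun_eq_iff by (metis (mono_tags) mem_Collect_eq not_le)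
    finally show ?thesis .
  qed
  have "f ` topspace (Euclidean_space ?n) = UNIV"
    using homeomorphic_imp_surjective_map [OF hm] by simp
  then have im: "f ` (topspace (Euclidean_space ?n) - {?o}) = - {0}"
    using f0 by (auto simp: image_iff)
  have top0: "topspace (Euclidean_space 0) = {?o}"
    by (auto simp: topspace_Euclidean_space)
  have "homology_group 0 (Euclidean_space 0) \<cong> integer_group"
    by (rule homology_coefficients [OF top0])
  \<comment> \<open>Adding \<open>n\<close> dimensions shifts the degree by \<open>n\<close>, so it suffices to look at the
    zero-dimensional space, where the complement of the origin is empty.\<close>
  moreover have "relative_homology_group 0 (Euclidean_space 0) (topspace (Euclidean_space 0) - {?o})
      \<cong> relative_homology_group (0 + int ?n) (Euclidean_space (0 + ?n))
          (topspace (Euclidean_space (0 + ?n)) - {?o})"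
    by (rule relative_homology_group_Euclidean_complement_step)
      (metis closedin_topspace top0)
  moreover have "relative_homology_group (int ?n) (Euclidean_space ?n) (topspace (Euclidean_space ?n) - {?o})
      \<cong> relative_homology_group (int ?n) ?E (- {0})"
    using homeomorphic_map_relative_homology_iso [OF hm Diff_subset im] is_isoI by blast
  ultimately show ?thesis
    by (simp add: top0) (meson group.iso_sym group_relative_homology_group iso_trans)
qed

text \<open>The image of 1 under an isomorphism from the integers. Distinct powers of this class are
  distinct, which is what determines the exponent in the definition of the degree.\<close>

lemma infinite_order_punctured_euclidean:
  obtains y where
    "y \<in> carrier (relative_homology_group (int DIM('a)) (euclidean :: 'a::euclidean_space topology) (- {0}))"
    "\<And>i j::int. y [^]\<^bsub>relative_homology_group (int DIM('a)) (euclidean :: 'a topology) (- {0})\<^esub> i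
       = y [^]\<^bsub>relative_homology_group (int DIM('a)) (euclidean :: 'a topology) (- {0})\<^esub> j \<Longrightarrow> i = j"
proof -
  let ?G = "relative_homology_group (int DIM('a)) (euclidean :: 'a topology) (- {0})"
  have "integer_group \<cong> ?G"
    using relative_homology_group_punctured_euclidean group.iso_sym group_relative_homology_group
    by blast
  then obtain h where h: "h \<in> iso integer_group ?G"
    by (auto simp: is_iso_def)
  then interpret group_hom integer_group ?G h
    by (simp add: group_hom_def group_hom_axioms_def iso_def)
  have pow: "h 1 [^]\<^bsub>?G\<^esub> i = h i" for i :: int
    using hom_int_pow [of 1 i] by simp
  show thesis
  proof
    show "h 1 \<in> carrier ?G" by simp
    show "i = j" if "h 1 [^]\<^bsub>?G\<^esub> i = h 1 [^]\<^bsub>?G\<^esub> j" for i j :: int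
      using that h by (simp add: pow iso_def bij_betw_def inj_on_def)
  qed
qed

text \<open>The punctured space deforms radially into the complement of the ball, so this pair has
  trivial relative homology. The exact sequence of the triple \<open>(E, E - {0}, E - B)\<close>
  then gives surjectivity.\<close>

lemma surj_ball_complement_punctured_euclidean:
  assumes "0 < r"
  shows "hom_induced p (euclidean :: 'a::euclidean_space topology) (- ball 0 r) euclidean (- {0}) id `
           carrier (relative_homology_group p euclidean (- ball 0 r))
         = carrier (relative_homology_group p euclidean (- {0}))"
proof -
  let ?S = "- {0} :: 'a set" and ?T = "- ball 0 r :: 'a set"
  \<comment> \<open>\<open>?f\<close> pushes the points of the punctured ball out to the sphere and
    fixes all others. \<open>?h\<close> is the straight line from \<open>?f\<close> to the identity;
    its factor is at least 1, so norms never shrink below \<open>r\<close>.\<close>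
  let ?f = "\<lambda>x::'a. max 1 (r / norm x) *\<^sub>R x"
  let ?h = "\<lambda>(t, x). ((1 - t) * max 1 (r / norm x) + t) *\<^sub>R x"
  have TS: "?T \<subseteq> ?S" using assms by auto
  have pos: "(1 - t) * max 1 (r / norm x) + t \<ge> 1" if "t \<in> {0..1}" for t and x :: 'a
  proof -
    have "(1 - t) * 1 \<le> (1 - t) * max 1 (r / norm x)"
      using that by (intro mult_left_mono) auto
    then show ?thesis by simp
  qed
  have contf: "continuous_on ?S ?f"
    by (intro continuous_intros) auto
  have fT: "?f x \<in> ?T" if "x \<in> ?S" for x
  proof -
    have "max 1 (r / norm x) * norm x \<ge> (r / norm x) * norm x"
      by (intro mult_right_mono) auto
    then show ?thesis using that by simp
  qed
  have conth: "continuous_on ({0..1} \<times> ?S) ?h"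
    unfolding split_def by (intro continuous_intros) auto
  have hS: "?h (t, x) \<in> ?S" if "t \<in> {0..1}" "x \<in> ?S" for t x
    using that pos [of t x] by auto
  have hT: "?h (t, x) \<in> ?T" if "t \<in> {0..1}" "x \<in> ?T" for t x
  proof -
    have "1 * norm x \<le> ((1 - t) * max 1 (r / norm x) + t) * norm x"
      using pos [OF that(1)] by (intro mult_right_mono) auto
    then show ?thesis
      using that pos [OF that(1), of x] by auto
  qed
  have prod: "prod_topology (top_of_set {0..1::real}) (top_of_set A) = top_of_set ({0..1} \<times> A)"
    for A :: "'a set"
    by (simp add: prod_topology_subtopology_eu)
  have hom: "homotopic_with (\<lambda>h. True) (top_of_set A) (top_of_set A) ?f id"
    if "A \<subseteq> ?S" "\<And>t x. t \<in> {0..1} \<Longrightarrow> x \<in> A \<Longrightarrow> ?h (t, x) \<in> A" for A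
    unfolding homotopic_with_def prod
  proof (intro exI conjI)
    show "continuous_map (top_of_set ({0..1} \<times> A)) (top_of_set A) ?h"
      using that continuous_on_subset [OF conth, of "{0..1} \<times> A"]
      by (fastforce simp: continuous_map_in_subtopology)
  qed auto
  \<comment> \<open>The boundary map of the triple lowers the degree by one, hence
    \<open>p - 1\<close>.\<close>
  have "trivial_group (relative_homology_group (p - 1) (top_of_set ?S) ?T)"
  proof (rule trivial_relative_homology_group_gen)
    have eq: "subtopology (top_of_set ?S) ?T = top_of_set ?T"
      using TS by (simp add: subtopology_subtopology Int_absorb1)
    show "continuous_map (top_of_set ?S) (subtopology (top_of_set ?S) ?T) ?f"
      unfolding eq using contf fT by (auto simp: continuous_map_in_subtopology)
    show "homotopic_with (\<lambda>h. True) (subtopology (top_of_set ?S) ?T) (subtopology (top_of_set ?S) ?T) ?f id"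
      unfolding eq using hom [OF TS] hT by blast
    show "homotopic_with (\<lambda>h. True) (top_of_set ?S) (top_of_set ?S) ?f id"
      using hom [OF subset_refl] hS by blast
  qed
  then have triv: "carrier (relative_homology_group (p - 1) (top_of_set ?S) ?T)
      = {\<one>\<^bsub>relative_homology_group (p - 1) (top_of_set ?S) ?T\<^esub>}"
    by (simp add: trivial_group_def)
  have "kernel (relative_homology_group p euclidean ?S)
          (relative_homology_group (p - 1) (top_of_set ?S) ?T) (hom_relboundary p euclidean ?S ?T)
        = hom_induced p euclidean ?T euclidean ?S id ` carrier (relative_homology_group p euclidean ?T)"
    using homology_exactness_triple_1 [OF TS, of p euclidean] by simp
  moreover have "hom_relboundary p euclidean ?S ?T c = \<one>\<^bsub>relative_homology_group (p - 1) (top_of_set ?S) ?T\<^esub>" for c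
    using hom_relboundary [of p euclidean ?S ?T c] triv by blast
  ultimately show ?thesis
    by (simp add: kernel_def)
qed

text \<open>The excised set is the complement of \<open>U\<close>, a closed set inside the open set
  \<open>- K\<close>.\<close>

lemma surj_excision_open:
  fixes U K :: "'a::euclidean_space set"
  assumes "open U" "closed K" "K \<subseteq> U"
  shows "hom_induced p (top_of_set U) (U - K) euclidean (- K) id `
           carrier (relative_homology_group p (top_of_set U) (U - K))
         = carrier (relative_homology_group p euclidean (- K))"
proof -
  have "hom_induced p (subtopology euclidean (UNIV - - U)) (- K - - U) (subtopology euclidean UNIV) (- K) id
      \<in> iso (relative_homology_group p (subtopology euclidean (UNIV - - U)) (- K - - U))
            (relative_homology_group p (subtopology euclidean UNIV) (- K))"
    using assms by (intro homology_excision_axiom) (auto simp: closure_closed interior_open open_closed)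
  moreover have "- K - - U = U - K" "UNIV - - U = U" by auto
  ultimately show ?thesis
    by (simp add: iso_def bij_betw_def)
qed

section \<open>Maps of degree one\<close>

text \<open>Homotopic maps of pairs induce the same map, so \<open>f\<close> may be replaced by
  \<open>id\<close>; the condition on \<open>d\<close> then compares a class with its own
  \<open>d\<close>-th power.\<close>

lemma brouwer_degree_eq_1:
  fixes f :: "'a::euclidean_space \<Rightarrow> 'a"
  assumes "open U" "bounded U" "0 \<in> U" "f 0 = 0"
    and hom: "homotopic_with (\<lambda>h. h \<in> U - {0} \<rightarrow> - {0}) (top_of_set U) euclidean f id"
  shows "brouwer_degree f U 0 = 1"
proof -
  let ?n = "int DIM('a)" and ?E = "euclidean :: 'a topology"
  let ?G = "relative_homology_group ?n ?E (- {0})"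
  have "f \<in> U - {0} \<rightarrow> - {0}"
    using homotopic_with_imp_property [OF hom] by blast
  then have K: "{x \<in> U. f x = 0} = {0}"
    using assms by auto
  have fid: "hom_induced ?n (top_of_set U) (U - {0}) ?E (- {0}) f
      = hom_induced ?n (top_of_set U) (U - {0}) ?E (- {0}) id"
    by (rule homology_homotopy_axiom [OF hom])
  obtain y where y: "y \<in> carrier ?G"
    and inj: "\<And>i j::int. y [^]\<^bsub>?G\<^esub> i = y [^]\<^bsub>?G\<^esub> j \<Longrightarrow> i = j"
    by (rule infinite_order_punctured_euclidean [where 'a = 'a]) blast
  obtain r where "0 < r" and r: "U \<subseteq> ball 0 r"
    using bounded_subset_ballD [OF \<open>bounded U\<close>] by blast
  have "y \<in> hom_induced ?n ?E (- ball 0 r) ?E (- {0}) id `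
      carrier (relative_homology_group ?n ?E (- ball 0 r))"
    unfolding surj_ball_complement_punctured_euclidean [OF \<open>0 < r\<close>] by (rule y)
  then obtain z where z: "z \<in> carrier (relative_homology_group ?n ?E (- ball 0 r))"
    and zy: "hom_induced ?n ?E (- ball 0 r) ?E (- {0}) id z = y"
    by blast
  have "y \<in> hom_induced ?n (top_of_set U) (U - {0}) ?E (- {0}) id `
      carrier (relative_homology_group ?n (top_of_set U) (U - {0}))"
    using surj_excision_open [of U "{0}" ?n] assms(1,3) y by simp
  then obtain w where w: "w \<in> carrier (relative_homology_group ?n (top_of_set U) (U - {0}))"
    and wy: "hom_induced ?n (top_of_set U) (U - {0}) ?E (- {0}) id w = y"
    by blast
  \<comment> \<open>\<open>z\<close> and \<open>w\<close> are needed only for uniqueness: they make the condition on \<open>d\<close> non-vacuous.\<close>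
  show ?thesis
    unfolding brouwer_degree_def K Let_def
  proof (rule the_equality, goal_cases)
    case 1
    show ?case
      by (simp add: fid hom_induced_carrier group.int_pow_1)
  next
    case (2 d)
    have "y = y [^]\<^bsub>?G\<^esub> d"
      using 2 [rule_format, of r z w] r \<open>0 < r\<close> z w zy wy by (simp add: fid)
    then show ?case
      using inj [of 1 d] y by (simp add: group.int_pow_1)
  qed
qed

text \<open>Every admissible neighbourhood has degree 1 by the homotopy over it, and the unit ball
  shows that no other common value is possible.\<close>

lemma local_degree_eq_1:
  fixes f :: "'a::euclidean_space \<Rightarrow> 'a"
  assumes "f 0 = 0"
    and hom: "\<And>U. \<lbrakk>open U; bounded U\<rbrakk> \<Longrightarrow>
      homotopic_with (\<lambda>h. h \<in> U - {0} \<rightarrow> - {0}) (top_of_set U) euclidean f id"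
  shows "local_degree f 0 = 1"
  unfolding local_degree_def
proof (rule the_equality, goal_cases)
  case 1
  show ?case
    using assms by (simp add: brouwer_degree_eq_1)
next
  case (2 d)
  \<comment> \<open>The homotopies over balls of every radius exclude nonzero zeros of
    \<open>f\<close> anywhere, in particular on the closed unit ball.\<close>
  have "f x \<noteq> 0" if "x \<noteq> 0" for x
  proof -
    have "f \<in> ball 0 (norm x + 1) - {0} \<rightarrow> - {0}"
      using homotopic_with_imp_property [OF hom [of "ball 0 (norm x + 1)"]] by auto
    then show ?thesis
      using that by (auto simp: Pi_iff)
  qed
  then have "brouwer_degree f (ball 0 1) 0 = d"
    using 2 [rule_format, of "ball 0 1"] assms(1) by auto
  moreover have "brouwer_degree f (ball 0 1) 0 = 1"
    using assms by (intro brouwer_degree_eq_1) auto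
  ultimately show ?case by simp
qed

section \<open>Zeros forced by the homotopy class on a sphere\<close>

lemma homotopic_with_into_subset:
  assumes "homotopic_with (\<lambda>h. h \<in> S' \<rightarrow> T) (top_of_set S) euclidean f g" "S \<subseteq> S'"
  shows "homotopic_with_canon (\<lambda>h. True) S T f g"
proof -
  obtain h where h: "continuous_map (prod_topology (top_of_set {0..1::real}) (top_of_set S)) euclidean h"
    "\<forall>x. h (0, x) = f x" "\<forall>x. h (1, x) = g x" "\<forall>t\<in>{0..1}. (\<lambda>x. h (t, x)) \<in> S' \<rightarrow> T"
    using assms(1) unfolding homotopic_with_def by blast
  then have "continuous_map (prod_topology (top_of_set {0..1::real}) (top_of_set S)) (top_of_set T) h"
    using assms(2) by (auto simp: continuous_map_in_subtopology Pi_iff)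
  then show ?thesis
    using h unfolding homotopic_with_def by blast
qed

text \<open>Without zeros, \<open>g\<close> would be nullhomotopic in the punctured space because
  the ball is contractible. So would the identity of the sphere, and the sphere would be
  contractible.\<close>

lemma homotopic_id_on_sphere_imp_zero:
  fixes g :: "'a::euclidean_space \<Rightarrow> 'a"
  assumes "0 < R" and cont: "continuous_on (cball 0 R) g"
    and hom: "homotopic_with_canon (\<lambda>h. True) (sphere 0 R) (- {0}) g id"
  obtains x where "g x = 0"
proof (rule ccontr)
  assume "\<not> thesis"
  then have nz: "g x \<noteq> 0" for x using that by blast
  \<comment> \<open>Radial retraction of the punctured space onto the sphere; it moves the
    nullhomotopy into the sphere itself.\<close>
  let ?r = "\<lambda>x::'a. (R / norm x) *\<^sub>R x"
  obtain c where "homotopic_with_canon (\<lambda>h. True) (cball 0 R) (- {0}) g (\<lambda>x. c)"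
    using nullhomotopic_from_contractible [OF cont, of "- {0}"] nz
    by (auto simp: convex_imp_contractible)
  then have "homotopic_with_canon (\<lambda>h. True) (sphere 0 R) (- {0}) g (\<lambda>x. c)"
    by (rule homotopic_with_subset_left) auto
  then have "homotopic_with_canon (\<lambda>h. True) (sphere 0 R) (- {0}) id (\<lambda>x. c)"
    using hom homotopic_with_symD homotopic_with_trans by blast
  moreover have "continuous_on (- {0}) ?r"
    by (intro continuous_intros) auto
  ultimately have "homotopic_with_canon (\<lambda>h. True) (sphere 0 R) (sphere 0 R) (?r \<circ> id) (?r \<circ> (\<lambda>x. c))"
    using \<open>0 < R\<close> by (intro homotopic_with_compose_continuous_left) (auto split: if_splits)
  then have "homotopic_with_canon (\<lambda>h. True) (sphere 0 R) (sphere 0 R) id (\<lambda>x. ?r c)"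
    using \<open>0 < R\<close> by (elim homotopic_with_eq) auto
  then have "contractible (sphere (0::'a) R)"
    unfolding contractible_def by blast
  then show False
    using \<open>0 < R\<close> by (simp add: contractible_sphere)
qed

section \<open>The minimum map of a homogeneous map\<close>

text \<open>An inner product with nonnegative terms vanishes only if every term does, and a minimum
  of two reals is 0 exactly when both are nonnegative with product 0.\<close>

lemma PCP_SOL_iff_min_map: "x \<in> PCP_SOL f q \<longleftrightarrow> min_map (\<lambda>x. f x + q) x = 0"
proof -
  have "(\<forall>i. 0 \<le> x $ i) \<and> (\<forall>i. 0 \<le> (f x + q) $ i) \<and> inner x (f x + q) = 0
    \<longleftrightarrow> (\<forall>i. 0 \<le> x $ i \<and> 0 \<le> (f x + q) $ i \<and> x $ i * (f x + q) $ i = 0)"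
    (is "?l \<longleftrightarrow> ?r")
  proof
    assume ?l
    then have "(\<Sum>i\<in>UNIV. x $ i * (f x + q) $ i) = 0"
      by (simp add: inner_vec_def)
    then have "\<forall>i\<in>UNIV. x $ i * (f x + q) $ i = 0"
      using \<open>?l\<close> by (subst (asm) sum_nonneg_eq_0_iff) auto
    then show ?r using \<open>?l\<close> by blast
  next
    assume ?r
    then show ?l unfolding inner_vec_def by (auto intro: sum.neutral)
  qed
  also have "\<dots> \<longleftrightarrow> (\<forall>i. min (x $ i) ((f x + q) $ i) = 0)"
    by (intro arg_cong [where f = All] ext) (auto simp: min_def)
  finally show ?thesis
    by (simp add: PCP_SOL_def min_map_def vec_eq_iff)
qed

text \<open>With a constant function as first argument, \<open>min_map\<close> is the componentwise
  minimum of two vectors that can vary independently.\<close>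

lemma continuous_on_min_map [continuous_intros]:
  fixes F :: "'a::topological_space \<Rightarrow> real ^ 'n"
  assumes "continuous_on S F" "continuous_on S G"
  shows "continuous_on S (\<lambda>x. min_map (\<lambda>_. F x) (G x))"
  unfolding min_map_def using assms by (intro continuous_intros) auto

text \<open>The minimum with a fixed number is 1-Lipschitz.\<close>

lemma norm_min_map_diff_le: "norm (min_map (\<lambda>_. a) x - min_map (\<lambda>_. b) x) \<le> norm (a - b)"
  by (rule norm_le_componentwise_cart) (auto simp: min_map_def min_def)

text \<open>Complementarity, unlike the minimum itself, is unaffected by scaling the two vectors
  with different positive factors.\<close>

lemma min_map_eq_0_scaleR:
  assumes "0 < s" "0 < t"
  shows "min_map (\<lambda>_. t *\<^sub>R y) (s *\<^sub>R x) = 0 \<longleftrightarrow> min_map (\<lambda>_. y) x = 0"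
proof -
  have "min a b = 0 \<longleftrightarrow> 0 \<le> a \<and> 0 \<le> b \<and> a * b = 0" for a b :: real
    by (auto simp: min_def)
  then have "min (s * a) (t * b) = 0 \<longleftrightarrow> min a b = 0" for a b
    using assms by (simp add: zero_le_mult_iff)
  then show ?thesis
    by (simp add: min_map_def vec_eq_iff)
qed

text \<open>Only the second entry of the minimum moves, along a segment. This serves both for a
  constant shift \<open>d\<close> and for a perturbation of lower growth.\<close>

lemma homotopic_min_map:
  fixes F G :: "real ^ 'n \<Rightarrow> real ^ 'n"
  assumes "continuous_on S F" "continuous_on S G"
    and nz: "\<And>t x. \<lbrakk>t \<in> {0..1}; x \<in> S - {0}\<rbrakk> \<Longrightarrow> min_map (\<lambda>x. F x + t *\<^sub>R G x) x \<noteq> 0"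
  shows "homotopic_with (\<lambda>h. h \<in> S - {0} \<rightarrow> - {0}) (top_of_set S) euclidean
           (min_map F) (min_map (\<lambda>x. F x + G x))"
  unfolding homotopic_with_def prod_topology_subtopology_eu
proof (intro exI conjI allI ballI)
  let ?h = "\<lambda>(t, x). min_map (\<lambda>_. F x + t *\<^sub>R G x) x"
  show "continuous_map (top_of_set ({0..1} \<times> S)) euclidean ?h"
    unfolding split_def continuous_map_iff_continuous
    using assms by (intro continuous_intros continuous_on_compose2 [OF assms(1)] continuous_on_compose2 [OF assms(2)]) auto
  show "?h (0, x) = min_map F x" "?h (1, x) = min_map (\<lambda>x. F x + G x) x" for x
    by (simp_all add: min_map_def)
  show "(\<lambda>x. ?h (t, x)) \<in> S - {0} \<rightarrow> - {0}" if "t \<in> {0..1}" for t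
    using nz [OF that] by (auto simp: min_map_def)
qed


text \<open>Two homotopies are joined: adding \<open>t d\<close>, then zooming in on the origin.
  Boundedness of \<open>S\<close> lets one final scale serve for all its points.\<close>

lemma homotopic_min_map_id:
  fixes F :: "real ^ 'n \<Rightarrow> real ^ 'n"
  assumes cont: "continuous_on UNIV F"
    and homog: "\<And>s x. F (s *\<^sub>R x) = s ^ k *\<^sub>R F x" and "0 < k"
    and zero: "\<And>x. min_map F x = 0 \<Longrightarrow> x = 0"
    and d: "\<And>i. 0 < d $ i" and zero_d: "\<And>x. min_map (\<lambda>x. F x + d) x = 0 \<Longrightarrow> x = 0"
    and "bounded S"
  shows "homotopic_with (\<lambda>h. h \<in> S - {0} \<rightarrow> - {0}) (top_of_set S) euclidean (min_map F) id"
proof -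
  have nz: "x = 0" if "t \<in> {0..1}" and x: "min_map (\<lambda>x. F x + t *\<^sub>R d) x = 0" for t x
  proof (cases "t = 0")
    case True
    then show ?thesis using x zero by simp
  next
    case False
    then have "0 < t" using that by auto
    \<comment> \<open>With \<open>t = s ^ k\<close> and \<open>x = s y\<close>, homogeneity turns
      \<open>F x + t d\<close> into \<open>t (F y + d)\<close>.\<close>
    define s where "s = root k t"
    have s: "0 < s" "s ^ k = t"
      using \<open>0 < t\<close> \<open>0 < k\<close> by (simp_all add: s_def)
    define y where "y = (1 / s) *\<^sub>R x"
    have xy: "x = s *\<^sub>R y" using s by (simp add: y_def)
    have "min_map (\<lambda>_. t *\<^sub>R (F y + d)) (s *\<^sub>R y) = 0"
      using x by (simp add: xy min_map_def homog s scaleR_add_right)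
    then have "min_map (\<lambda>_. F y + d) y = 0"
      using min_map_eq_0_scaleR s \<open>0 < t\<close> by blast
    then have "min_map (\<lambda>x. F x + d) y = 0"
      by (simp add: min_map_def)
    then show ?thesis using zero_d xy by simp
  qed
  have hom1: "homotopic_with (\<lambda>h. h \<in> S - {0} \<rightarrow> - {0}) (top_of_set S) euclidean
      (min_map F) (min_map (\<lambda>x. F x + d))"
    using nz by (intro homotopic_min_map continuous_on_subset [OF cont]) auto
  have "F 0 = 0"
    using homog [of 0 0] \<open>0 < k\<close> by (simp add: zero_power)
  have "isCont F 0"
    using cont by (simp add: continuous_on_eq_continuous_at)
  then have lim: "((\<lambda>y. (F y + d - y) $ i) \<longlongrightarrow> (F 0 + d - 0) $ i) (nhds 0)" for i
    by (intro tendsto_intros) (auto simp: isCont_def tendsto_nhds_iff filterlim_ident)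
  \<comment> \<open>The limit is \<open>d $ i > 0\<close>, so near the origin the minimum selects
    \<open>y\<close> in every component.\<close>
  have "\<forall>\<^sub>F y in nhds 0. 0 < (F y + d - y) $ i" for i
    by (rule order_tendstoD(1) [OF lim]) (simp add: d \<open>F 0 = 0\<close>)
  then have "\<forall>\<^sub>F y in nhds 0. \<forall>i. 0 < (F y + d - y) $ i"
    by (rule eventually_all_finite)
  then obtain \<delta> where "0 < \<delta>" and \<delta>: "\<And>y i. norm y < \<delta> \<Longrightarrow> y $ i < (F y + d) $ i"
    by (auto simp: eventually_nhds_metric dist_norm)
  obtain B where "0 < B" and B: "\<And>x. x \<in> S \<Longrightarrow> norm x \<le> B"
    using \<open>bounded S\<close> by (auto simp: bounded_pos)
  \<comment> \<open>This makes \<open>norm (e x) \<le> \<delta> / 2\<close> on all of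
    \<open>S\<close>. The cap at 1 keeps the scale \<open>?s t\<close> at least \<open>e\<close>,
    hence positive.\<close>
  define e where "e = min 1 (\<delta> / (2 * B))"
  have e: "0 < e" "e \<le> 1"
    using \<open>0 < \<delta>\<close> \<open>0 < B\<close> by (auto simp: e_def)
  have small: "min_map (\<lambda>_. F (e *\<^sub>R x) + d) (e *\<^sub>R x) = e *\<^sub>R x" if "x \<in> S" for x
  proof -
    have "e * norm x \<le> \<delta> / (2 * B) * B"
      using B [OF that] \<open>0 < B\<close> \<open>0 < \<delta>\<close> e by (intro mult_mono) (auto simp: e_def)
    then have "norm (e *\<^sub>R x) < \<delta>"
      using e \<open>0 < B\<close> \<open>0 < \<delta>\<close> by simp
    then show ?thesis
      using less_imp_le [OF \<delta>] by (simp only: min_map_def vec_lambda_beta vec_eq_iff min_absorb1 simp_thms)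
  qed
  \<comment> \<open>The scale decreases linearly from 1 to \<open>e\<close>; \<open>?h\<close> zooms
    by this scale and normalises.\<close>
  let ?s = "\<lambda>t. 1 - t * (1 - e)"
  let ?h = "\<lambda>(t, x). (1 / ?s t) *\<^sub>R min_map (\<lambda>_. F (?s t *\<^sub>R x) + d) (?s t *\<^sub>R x)"
  have s: "0 < ?s t" if "t \<in> {0..1}" for t
  proof -
    have "t * (1 - e) \<le> 1 * (1 - e)"
      using that e by (intro mult_right_mono) auto
    then show ?thesis using e by simp
  qed
  have hom2: "homotopic_with (\<lambda>h. h \<in> S - {0} \<rightarrow> - {0}) (top_of_set S) euclidean
      (min_map (\<lambda>x. F x + d)) (\<lambda>x. (1 / e) *\<^sub>R min_map (\<lambda>_. F (e *\<^sub>R x) + d) (e *\<^sub>R x))"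
    unfolding homotopic_with_def prod_topology_subtopology_eu
  proof (intro exI conjI allI ballI)
    show "continuous_map (top_of_set ({0..1} \<times> S)) euclidean ?h"
      unfolding split_def continuous_map_iff_continuous
      using s by (intro continuous_intros continuous_on_compose2 [OF cont]) force+
    show "?h (0, x) = min_map (\<lambda>x. F x + d) x"
      "?h (1, x) = (1 / e) *\<^sub>R min_map (\<lambda>_. F (e *\<^sub>R x) + d) (e *\<^sub>R x)" for x
      by (simp_all add: min_map_def)
    show "(\<lambda>x. ?h (t, x)) \<in> S - {0} \<rightarrow> - {0}" if "t \<in> {0..1}" for t
    proof
      fix x assume "x \<in> S - {0}"
      then have "min_map (\<lambda>x. F x + d) (?s t *\<^sub>R x) \<noteq> 0"
        using zero_d [of "?s t *\<^sub>R x"] s [OF that] by auto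
      then show "?h (t, x) \<in> - {0}"
        using s [OF that] by (simp add: min_map_def)
    qed
  qed
  have "homotopic_with (\<lambda>h. h \<in> S - {0} \<rightarrow> - {0}) (top_of_set S) euclidean
      (min_map F) (\<lambda>x. (1 / e) *\<^sub>R min_map (\<lambda>_. F (e *\<^sub>R x) + d) (e *\<^sub>R x))"
    using homotopic_with_trans [OF hom1 hom2] .
  then show ?thesis
    by (rule homotopic_with_eq) (use small e in \<open>auto simp: Pi_iff\<close>)
qed

section \<open>Perturbations of lower growth\<close>

text \<open>Rescaling a zero of norm \<open>s\<close> to the unit sphere shrinks the perturbation to
  at most \<open>C / s\<close>, while the unperturbed minimum map has norm at least some
  \<open>\<mu> > 0\<close> there. Hence \<open>s \<le> C / \<mu>\<close>.\<close>

lemma min_map_perturbed_zeros_bounded: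
  fixes F G :: "real ^ 'n \<Rightarrow> real ^ 'n"
  assumes cont: "continuous_on UNIV F"
    and homog: "\<And>s x. F (s *\<^sub>R x) = s ^ k *\<^sub>R F x" and "0 < k"
    and zero: "\<And>x. min_map F x = 0 \<Longrightarrow> x = 0"
    and G: "\<And>x. 1 \<le> norm x \<Longrightarrow> norm (G x) \<le> C * norm x ^ (k - 1)"
  obtains R where "0 < R"
    "\<And>t x. \<lbrakk>t \<in> {0..1}; min_map (\<lambda>x. F x + t *\<^sub>R G x) x = 0\<rbrakk> \<Longrightarrow> norm x < R"
proof -
  have "continuous_on (sphere 0 1) (\<lambda>u. norm (min_map (\<lambda>_. F u) u))"
    by (intro continuous_intros continuous_on_subset [OF cont]) auto
  then have "\<exists>v\<in>sphere 0 1. \<forall>u\<in>sphere 0 1. norm (min_map (\<lambda>_. F v) v) \<le> norm (min_map (\<lambda>_. F u) u)"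
    by (intro continuous_attains_inf) auto
  then obtain v :: "real ^ 'n" where v: "norm v = 1"
    and min: "\<And>u. norm u = 1 \<Longrightarrow> norm (min_map F v) \<le> norm (min_map F u)"
    by (auto simp: min_map_def)
  define \<mu> where "\<mu> = norm (min_map F v)"
  have "0 < \<mu>"
    using zero [of v] v by (auto simp: \<mu>_def)
  have bound: "norm x \<le> C / \<mu>"
    if t: "t \<in> {0..1}" and x: "min_map (\<lambda>x. F x + t *\<^sub>R G x) x = 0" and x1: "1 \<le> norm x" for t x
  proof -
    define s where "s = norm x"
    define u where "u = (1 / s) *\<^sub>R x"
    have "1 \<le> s" using x1 by (simp add: s_def)
    then have xu: "x = s *\<^sub>R u" and "norm u = 1"
      by (auto simp: u_def s_def)
    \<comment> \<open>The perturbation term after division by \<open>s ^ k\<close>.\<close>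
    let ?e = "(t / s ^ k) *\<^sub>R G x"
    have "F x + t *\<^sub>R G x = s ^ k *\<^sub>R (F u + ?e)"
      using \<open>1 \<le> s\<close> xu homog [of s u] by (simp add: scaleR_add_right)
    then have "min_map (\<lambda>_. s ^ k *\<^sub>R (F u + ?e)) (s *\<^sub>R u) = 0"
      using x xu by (simp add: min_map_def)
    then have "min_map (\<lambda>_. F u + ?e) u = 0"
      using min_map_eq_0_scaleR [of s "s ^ k"] \<open>1 \<le> s\<close> by fastforce
    then have "norm (min_map (\<lambda>_. F u) u) \<le> norm ?e"
      using norm_min_map_diff_le [of "F u" u "F u + ?e"] by simp
    then have "\<mu> \<le> norm ?e"
      using min [OF \<open>norm u = 1\<close>] by (simp add: \<mu>_def min_map_def)
    also have "\<dots> = t * norm (G x) / s ^ k"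
      using t \<open>1 \<le> s\<close> by simp
    also have "\<dots> \<le> 1 * (C * s ^ (k - 1)) / s ^ k"
      using t \<open>1 \<le> s\<close> G [OF x1] by (intro divide_right_mono mult_mono) (auto simp: s_def)
    also have "\<dots> = C / s"
      using \<open>0 < k\<close> \<open>1 \<le> s\<close> by (cases k) auto
    finally have "\<mu> * s \<le> C"
      using \<open>1 \<le> s\<close> by (simp add: pos_le_divide_eq)
    then show ?thesis
      using \<open>0 < \<mu>\<close> by (simp add: s_def pos_le_divide_eq mult.commute)
  qed
  show thesis
  proof
    \<comment> \<open>The maximum with 1 covers zeros of norm below 1, where the growth bound says
      nothing; adding 1 makes the inequality strict.\<close>
    show "0 < max 1 (C / \<mu>) + 1" by simp
    show "norm x < max 1 (C / \<mu>) + 1"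
      if "t \<in> {0..1}" "min_map (\<lambda>x. F x + t *\<^sub>R G x) x = 0" for t x
      using bound [OF that] by fastforce
  qed
qed

text \<open>On a sphere enclosing all zeros, the perturbed minimum map is homotopic to
  \<open>min_map F\<close> and thus to the identity, which forces a zero. The zero set is closed by
  continuity and bounded by the same radius.\<close>

lemma PCP_SOL_perturbed_nonempty_compact:
  fixes F P :: "real ^ 'n \<Rightarrow> real ^ 'n"
  assumes cont: "continuous_on UNIV F" "continuous_on UNIV P"
    and homog: "\<And>s x. F (s *\<^sub>R x) = s ^ k *\<^sub>R F x" and "0 < k"
    and zero: "\<And>x. min_map F x = 0 \<Longrightarrow> x = 0"
    and d: "\<And>i. 0 < d $ i" and zero_d: "\<And>x. min_map (\<lambda>x. F x + d) x = 0 \<Longrightarrow> x = 0"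
    and P: "\<And>x. 1 \<le> norm x \<Longrightarrow> norm (P x) \<le> C * norm x ^ (k - 1)"
  shows "PCP_SOL (\<lambda>x. F x + P x) q \<noteq> {} \<and> compact (PCP_SOL (\<lambda>x. F x + P x) q)"
proof -
  define G where "G = (\<lambda>x. P x + q)"
  have contG: "continuous_on UNIV G"
    unfolding G_def by (intro continuous_intros cont)
  \<comment> \<open>The constant \<open>q\<close> is absorbed into the perturbation, since
    \<open>norm x ^ (k - 1)\<close> is at least 1 here.\<close>
  have G: "norm (G x) \<le> (C + norm q) * norm x ^ (k - 1)" if "1 \<le> norm x" for x
  proof -
    have "norm q * 1 \<le> norm q * norm x ^ (k - 1)"
      using that by (intro mult_left_mono) auto
    then show ?thesis
      using norm_triangle_ineq [of "P x" q] P [OF that] by (simp add: G_def algebra_simps)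
  qed
  obtain R where "0 < R"
    and R: "\<And>t x. \<lbrakk>t \<in> {0..1}; min_map (\<lambda>x. F x + t *\<^sub>R G x) x = 0\<rbrakk> \<Longrightarrow> norm x < R"
    using min_map_perturbed_zeros_bounded [of F k G "C + norm q"] cont(1) homog \<open>0 < k\<close> zero G by blast
  let ?g = "min_map (\<lambda>x. F x + G x)"
  have contg: "continuous_on UNIV ?g"
    using continuous_on_min_map [of UNIV "\<lambda>x. F x + G x" "\<lambda>x. x"] cont contG
    by (simp add: min_map_def continuous_on_add)
  have sol: "PCP_SOL (\<lambda>x. F x + P x) q = ?g -` {0}"
    by (auto simp: PCP_SOL_iff_min_map G_def add.assoc)
  have "homotopic_with (\<lambda>h. h \<in> sphere 0 R - {0} \<rightarrow> - {0}) (top_of_set (sphere 0 R)) euclidean (min_map F) ?g"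
  proof (rule homotopic_min_map)
    show "min_map (\<lambda>x. F x + t *\<^sub>R G x) x \<noteq> 0" if "t \<in> {0..1}" "x \<in> sphere 0 R - {0}" for t x
      using R [OF that(1), of x] that(2) by auto
  qed (auto intro: continuous_on_subset [OF cont(1)] continuous_on_subset [OF contG])
  moreover have "homotopic_with (\<lambda>h. h \<in> sphere 0 R - {0} \<rightarrow> - {0}) (top_of_set (sphere 0 R)) euclidean (min_map F) id"
    using cont(1) homog \<open>0 < k\<close> zero d zero_d by (rule homotopic_min_map_id) (auto intro: bounded_subset [OF bounded_cball sphere_cball])
  ultimately have "homotopic_with (\<lambda>h. h \<in> sphere 0 R - {0} \<rightarrow> - {0}) (top_of_set (sphere 0 R)) euclidean ?g id"
    using homotopic_with_symD homotopic_with_trans by blast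
  then have "homotopic_with_canon (\<lambda>h. True) (sphere 0 R) (- {0}) ?g id"
    using \<open>0 < R\<close> by (intro homotopic_with_into_subset) auto
  then obtain x where "?g x = 0"
    using homotopic_id_on_sphere_imp_zero [OF \<open>0 < R\<close>] contg continuous_on_subset by blast
  then have "PCP_SOL (\<lambda>x. F x + P x) q \<noteq> {}"
    using sol by auto
  \<comment> \<open>The end \<open>t = 1\<close> of the linear homotopy is \<open>?g\<close>
    itself.\<close>
  moreover have "bounded (?g -` {0})"
    using R [of 1] by (intro boundedI [of _ R]) (auto intro: less_imp_le)
  moreover have "closed (?g -` {0})"
    using contg by (intro continuous_closed_vimage) (auto simp: continuous_on_eq_continuous_at)
  ultimately show ?thesis
    by (simp add: sol compact_eq_bounded_closed)
qed

section \<open>Tensors\<close>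

lemma continuous_on_tensor_map:
  fixes A :: "'n::finite list \<Rightarrow> real"
  shows "continuous_on S (tensor_map m A)"
proof -
  have "continuous_on S (\<lambda>x :: real ^ 'n. \<Prod>j\<leftarrow>js. x $ j)" for js
    by (induction js) (auto intro!: continuous_intros)
  then show ?thesis
    unfolding tensor_map_def by (intro continuous_intros) auto
qed

lemma tensor_map_scaleR: "tensor_map m A (s *\<^sub>R x) = s ^ (m - 1) *\<^sub>R tensor_map m A x"
proof -
  have "(\<Prod>j\<leftarrow>js. s * x $ j) = s ^ length js * (\<Prod>j\<leftarrow>js. x $ j)" for js
    by (induction js) auto
  then show ?thesis
    by (simp add: tensor_map_def vec_eq_iff sum_distrib_left mult.left_commute)
qed

section \<open>Continuity and growth of polynomial maps\<close>

lemma continuous_on_poly_map: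
  assumes "poly_map_degree_less k P"
  shows "continuous_on S P"
proof -
  obtain c where "\<And>x i. P x $ i = (\<Sum>\<alpha> | (\<Sum>j\<in>UNIV. \<alpha> j) < k. c i \<alpha> * (\<Prod>j\<in>UNIV. (x $ j) ^ \<alpha> j))"
    using assms unfolding poly_map_degree_less_def by blast
  then have "P = (\<lambda>x. \<chi> i. \<Sum>\<alpha> | (\<Sum>j\<in>UNIV. \<alpha> j) < k. c i \<alpha> * (\<Prod>j\<in>UNIV. (x $ j) ^ \<alpha> j))"
    by (simp add: fun_eq_iff vec_eq_iff)
  then show ?thesis
    by (simp only:) (intro continuous_intros)
qed

text \<open>Outside the open unit ball a monomial of degree below \<open>k\<close> is at most
  \<open>norm x ^ (k - 1)\<close>, so the sum of all absolute coefficients serves as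
  \<open>C\<close>.\<close>

lemma poly_map_growth:
  fixes P :: "real ^ 'n \<Rightarrow> real ^ 'n"
  assumes "poly_map_degree_less k P"
  obtains C where "\<And>x. 1 \<le> norm x \<Longrightarrow> norm (P x) \<le> C * norm x ^ (k - 1)"
proof -
  obtain c where c: "\<And>x i. P x $ i = (\<Sum>\<alpha> | (\<Sum>j\<in>UNIV. \<alpha> j) < k. c i \<alpha> * (\<Prod>j\<in>UNIV. (x $ j) ^ \<alpha> j))"
    using assms unfolding poly_map_degree_less_def by blast
  let ?N = "{\<alpha> :: 'n \<Rightarrow> nat. (\<Sum>j\<in>UNIV. \<alpha> j) < k}"
  have "norm (P x) \<le> (\<Sum>i\<in>UNIV. \<Sum>\<alpha>\<in>?N. \<bar>c i \<alpha>\<bar>) * norm x ^ (k - 1)" if "1 \<le> norm x" for x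
  proof -
    have monomial: "\<bar>\<Prod>j\<in>UNIV. (x $ j) ^ \<alpha> j\<bar> \<le> norm x ^ (k - 1)" if "\<alpha> \<in> ?N" for \<alpha>
    proof -
      have "\<bar>\<Prod>j\<in>UNIV. (x $ j) ^ \<alpha> j\<bar> \<le> (\<Prod>j\<in>UNIV. norm x ^ \<alpha> j)"
        unfolding abs_prod by (intro prod_mono) (auto simp: power_abs intro!: power_mono component_le_norm_cart)
      also have "\<dots> = norm x ^ (\<Sum>j\<in>UNIV. \<alpha> j)"
        by (simp add: power_sum)
      also have "\<dots> \<le> norm x ^ (k - 1)"
        using that \<open>1 \<le> norm x\<close> by (intro power_increasing) auto
      finally show ?thesis .
    qed
    have "norm (P x) \<le> (\<Sum>i\<in>UNIV. \<bar>P x $ i\<bar>)"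
      by (rule norm_le_l1_cart)
    also have "\<dots> \<le> (\<Sum>i\<in>UNIV. \<Sum>\<alpha>\<in>?N. \<bar>c i \<alpha>\<bar> * norm x ^ (k - 1))"
      unfolding c
      by (intro sum_mono order_trans [OF sum_abs])
        (simp add: abs_mult mult_left_mono monomial del: One_nat_def)
    finally show ?thesis
      by (simp add: sum_distrib_right)
  qed
  then show thesis by (rule that)
qed

theorem corollary5p2:
  fixes A :: "'n::finite list \<Rightarrow> real" and m :: nat
  assumes "m \<ge> 2" and "R_tensor m A"
  shows "tensor_degree m A = 1 \<and> strong_Q_tensor m A"
proof -
  let ?F = "tensor_map m A"
  obtain d where d: "\<And>i. 0 < d $ i" and sol: "PCP_SOL ?F 0 = {0}" "PCP_SOL ?F d = {0}"
    using assms unfolding R_tensor_def R0_tensor_def by blast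
  have zero: "x = 0" if "min_map ?F x = 0" for x
    using that sol(1) PCP_SOL_iff_min_map [of x ?F 0] by simp
  have zero_d: "x = 0" if "min_map (\<lambda>x. ?F x + d) x = 0" for x
    using that sol(2) PCP_SOL_iff_min_map [of x ?F d] by simp
  have k: "0 < m - 1" using assms(1) by simp
  note F = continuous_on_tensor_map [of UNIV m A] tensor_map_scaleR [of m A] k
  have "min_map ?F 0 = 0"
    using sol(1) PCP_SOL_iff_min_map [of 0 ?F 0] by simp
  moreover have "homotopic_with (\<lambda>h. h \<in> U - {0} \<rightarrow> - {0}) (top_of_set U) euclidean (min_map ?F) id"
    if "bounded U" for U
    using F zero d zero_d that by (rule homotopic_min_map_id)
  ultimately have "tensor_degree m A = 1"
    unfolding tensor_degree_def by (intro local_degree_eq_1)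
  moreover have "strong_Q_tensor m A"
    unfolding strong_Q_tensor_def
  proof (intro allI impI)
    fix P :: "real ^ 'n \<Rightarrow> real ^ 'n" and q
    assume P: "poly_map_degree_less (m - 1) P"
    \<comment> \<open>The exponent is one below the degree of homogeneity \<open>m - 1\<close>, as
      the perturbation lemma requires.\<close>
    obtain C where C: "\<And>x. 1 \<le> norm x \<Longrightarrow> norm (P x) \<le> C * norm x ^ (m - 1 - 1)"
      using poly_map_growth [OF P] by blast
    show "PCP_SOL (\<lambda>x. ?F x + P x) q \<noteq> {} \<and> compact (PCP_SOL (\<lambda>x. ?F x + P x) q)"
      using F(1) continuous_on_poly_map [OF P] F(2,3) zero d zero_d C
      by (rule PCP_SOL_perturbed_nonempty_compact)
  qed
  ultimately show ?thesis ..
qed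

end
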